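(* Let $\mathcal{M} = \mathbb{H}^2$. There exists data $(F_i, x_i, g_i)_{i=1}^3$, with $F_i\in\mathbb{R}$, $x_i\in\mathcal{M}$ and $g_i\in\mathrm{T}_{x_i}\mathcal{M}$, such that $F_j \geq F_i + \langle g_i, \log_{x_i}(x_j)\rangle$ for all $i, j \in \{1,2,3\}$, yet this data cannot be interpolated by any g-convex function.
   Context: $\mathbb{H}^2$ is the hyperbolic plane of constant curvature $-1$; $\log_x$ is the inverse of the exponential map $\exp_x$. A function $f:\mathcal{M}\to\mathbb{R}$ is g-convex if $f(\gamma(t))\le(1-t)f(x)+tf(y)$ for every geodesic $\gamma:[0,1]\to\mathcal{M}$ from $x$ to $y$ and all $t\in[0,1]$. A subgradient of $f$ at $x$ is $g\in\mathrm{T}_x\mathcal{M}$ with $f(y)\ge f(x)+\langle g,\log_x(y)\rangle$ for all $y\in\mathcal{M}$; $\partial f(x)$ is the set of subgradients. The data $(F_i,x_i,g_i)_{i=1}^N$ is interpolated by a g-convex function $f:\mathcal{M}\to\mathbb{R}$ if $f(x_i)=F_i$ and $g_i\in\partial f(x_i)$ for all $i$. *)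

theory Defs
  imports "HOL-Analysis.Analysis"
begin

text \<open>
  The hyperbolic plane is realised as the hyperboloid model: the upper sheet of
  \<open>\<langle>x, x\<rangle> = -1\<close> in Minkowski space \<open>\<real>\<^sup>2 \<times> \<real>\<close>, whose last component is the time coordinate.
  The Lorentz form restricts to a positive definite inner product on every tangent space,
  giving the Riemannian metric of constant curvature \<open>-1\<close>.
\<close>

type_synonym minkowski = "(real ^ 2) \<times> real"

definition lorentz :: "minkowski \<Rightarrow> minkowski \<Rightarrow> real" where
  "lorentz x y = fst x \<bullet> fst y - snd x * snd y"

definition hyp_plane :: "minkowski set" where
  "hyp_plane = {x. lorentz x x = -1 \<and> snd x > 0}"

definition tangent_space :: "minkowski \<Rightarrow> minkowski set" where
  "tangent_space x = {v. lorentz x v = 0}"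

text \<open>
  For \<open>x\<close> in the hyperbolic plane, the Lorentz-orthogonal projection onto the tangent space
  at \<open>x\<close> is \<open>a - (\<langle>x, a\<rangle> / \<langle>x, x\<rangle>) x\<close>, and \<open>\<langle>x, x\<rangle> = -1\<close>.
\<close>

definition tangent_proj :: "minkowski \<Rightarrow> minkowski \<Rightarrow> minkowski" where
  "tangent_proj x a = a + lorentz x a *\<^sub>R x"

text \<open>
  A geodesic \<open>c\<close> on \<open>[0, 1]\<close> with velocity \<open>c'\<close>: the covariant derivative of the velocity, which
  for the induced metric is the tangential part of the acceleration in the ambient space, vanishes.
  Constant curves are included.
\<close>

definition geodesic :: "(real \<Rightarrow> minkowski) \<Rightarrow> (real \<Rightarrow> minkowski) \<Rightarrow> bool" where
  "geodesic c c' \<longleftrightarrow>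
     (\<forall>t\<in>{0..1}. c t \<in> hyp_plane \<and>
        (c has_vector_derivative c' t) (at t within {0..1}) \<and>
        (\<exists>a. (c' has_vector_derivative a) (at t within {0..1}) \<and> tangent_proj (c t) a = 0))"

definition hyp_exp :: "minkowski \<Rightarrow> minkowski \<Rightarrow> minkowski" where
  "hyp_exp x v = (THE y. \<exists>c c'. geodesic c c' \<and> c 0 = x \<and> c' 0 = v \<and> c 1 = y)"

definition hyp_log :: "minkowski \<Rightarrow> minkowski \<Rightarrow> minkowski" where
  "hyp_log x = the_inv_into (tangent_space x) (hyp_exp x)"

definition g_convex :: "(minkowski \<Rightarrow> real) \<Rightarrow> bool" where
  "g_convex f \<longleftrightarrow>
     (\<forall>x\<in>hyp_plane. \<forall>y\<in>hyp_plane. \<forall>c c'. geodesic c c' \<and> c 0 = x \<and> c 1 = y \<longrightarrow>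
        (\<forall>t\<in>{0..1}. f (c t) \<le> (1 - t) * f x + t * f y))"

definition subdifferential :: "(minkowski \<Rightarrow> real) \<Rightarrow> minkowski \<Rightarrow> minkowski set" where
  "subdifferential f x =
     {g \<in> tangent_space x. \<forall>y\<in>hyp_plane. f y \<ge> f x + lorentz g (hyp_log x y)}"

definition interpolates ::
  "nat \<Rightarrow> (nat \<Rightarrow> real) \<Rightarrow> (nat \<Rightarrow> minkowski) \<Rightarrow> (nat \<Rightarrow> minkowski) \<Rightarrow> (minkowski \<Rightarrow> real) \<Rightarrow> bool" where
  "interpolates N F x g f \<longleftrightarrow> (\<forall>i\<in>{1..N}. f (x i) = F i \<and> g i \<in> subdifferential f (x i))"

text \<open>
  The following facts show that the definite description and the inverse above are well defined:
  a geodesic is determined by its initial point and velocity, and the exponential map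
  is a bijection from each tangent space onto the hyperbolic plane.
\<close>

lemma lorentz_simps:
  "lorentz (x + y) z = lorentz x z + lorentz y z"
  "lorentz z (x + y) = lorentz z x + lorentz z y"
  "lorentz (x - y) z = lorentz x z - lorentz y z"
  "lorentz z (x - y) = lorentz z x - lorentz z y"
  "lorentz (r *\<^sub>R x) y = r * lorentz x y"
  "lorentz x (r *\<^sub>R y) = r * lorentz x y"
  "lorentz 0 x = 0" "lorentz x 0 = 0"
  by (simp_all add: lorentz_def inner_simps algebra_simps)

lemma lorentz_commute: "lorentz x y = lorentz y x"
  by (simp add: lorentz_def inner_commute mult.commute)

lemma lorentz_has_derivative:
  assumes "(c has_vector_derivative c') (at t within S)" "(d has_vector_derivative d') (at t within S)"
  shows "((\<lambda>t. lorentz (c t) (d t)) has_vector_derivative lorentz (c t) d' + lorentz c' (d t)) (at t within S)"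
proof -
  have f: "((\<lambda>t. fst (e t)) has_vector_derivative fst e') (at t within S)"
      "((\<lambda>t. snd (e t)) has_vector_derivative snd e') (at t within S)"
    if "(e has_vector_derivative e') (at t within S)" for e :: "real \<Rightarrow> minkowski" and e'
    using that bounded_linear.has_vector_derivative[OF bounded_linear_fst]
      bounded_linear.has_vector_derivative[OF bounded_linear_snd] by blast+
  have "((\<lambda>t. fst (c t) \<bullet> fst (d t)) has_vector_derivative (fst (c t) \<bullet> fst d' + fst c' \<bullet> fst (d t))) (at t within S)"
    using bounded_bilinear.has_vector_derivative[OF bounded_bilinear_inner f(1)[OF assms(1)] f(1)[OF assms(2)]] .
  moreover have "((\<lambda>t. snd (c t) * snd (d t)) has_vector_derivative (snd (c t) * snd d' + snd c' * snd (d t))) (at t within S)"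
    using bounded_bilinear.has_vector_derivative[OF bounded_bilinear_mult f(2)[OF assms(1)] f(2)[OF assms(2)]] .
  ultimately show ?thesis
    unfolding lorentz_def
    by (auto dest: has_vector_derivative_diff simp: algebra_simps)
qed

lemma has_vector_derivative_unique_01:
  assumes "(f has_vector_derivative a) (at t within {0..1::real})"
    and "(f has_vector_derivative b) (at t within {0..1})" and "t \<in> {0..1}"
  shows "a = b"
  using vector_derivative_unique_within_closed_interval[of 0 1 t f a b] assms by simp

lemma constant_01:
  fixes f :: "real \<Rightarrow> 'b :: real_normed_vector"
  assumes "\<And>t. t \<in> {0..1} \<Longrightarrow> (f has_vector_derivative 0) (at t within {0..1})" "t \<in> {0..1}"
  shows "f t = f 0"
proof -
  obtain k where "\<And>t. t \<in> {0..1} \<Longrightarrow> f t = k"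
    using has_vector_derivative_zero_constant[of "{0..1}" f] assms by (metis convex_real_interval(5))
  then show ?thesis using assms(2) by simp
qed

lemma lorentz_tangent_bound:
  assumes "x \<in> hyp_plane" "v \<in> tangent_space x"
  shows "(snd x)\<^sup>2 * lorentz v v \<ge> fst v \<bullet> fst v"
proof -
  have x: "(snd x)\<^sup>2 = 1 + fst x \<bullet> fst x" and v: "snd x * snd v = fst x \<bullet> fst v"
    using assms by (auto simp: hyp_plane_def tangent_space_def lorentz_def power2_eq_square)
  have "(snd x)\<^sup>2 * lorentz v v = (snd x)\<^sup>2 * (fst v \<bullet> fst v) - (snd x * snd v)\<^sup>2"
    by (simp add: lorentz_def algebra_simps power2_eq_square)
  then show ?thesis
    using Cauchy_Schwarz_ineq[of "fst x" "fst v"] unfolding x v by (simp add: algebra_simps)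
qed

lemma lorentz_tangent_nonneg:
  assumes "x \<in> hyp_plane" "v \<in> tangent_space x"
  shows "lorentz v v \<ge> 0"
proof -
  have "(snd x)\<^sup>2 > 0" using assms by (simp add: hyp_plane_def)
  moreover have "(snd x)\<^sup>2 * lorentz v v \<ge> 0"
    using lorentz_tangent_bound[OF assms] inner_ge_zero[of "fst v"] by linarith
  ultimately show ?thesis by (simp add: zero_le_mult_iff)
qed

lemma lorentz_tangent_zero:
  assumes "x \<in> hyp_plane" "v \<in> tangent_space x" "lorentz v v = 0"
  shows "v = 0"
proof -
  have "fst v \<bullet> fst v \<le> 0" using lorentz_tangent_bound[OF assms(1,2)] assms(3) by simp
  then have "fst v = 0" by (metis inner_ge_zero inner_eq_zero_iff order_antisym)
  moreover have "snd v = 0" using assms \<open>fst v = 0\<close>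
    by (auto simp: hyp_plane_def tangent_space_def lorentz_def)
  ultimately show ?thesis by (simp add: prod_eq_iff)
qed

lemma lorentz_hyp_le:
  assumes "x \<in> hyp_plane" "y \<in> hyp_plane"
  shows "- lorentz x y \<ge> 1"
proof -
  have x: "(snd x)\<^sup>2 = 1 + fst x \<bullet> fst x" and y: "(snd y)\<^sup>2 = 1 + fst y \<bullet> fst y"
    and pos: "snd x > 0" "snd y > 0"
    using assms by (auto simp: hyp_plane_def lorentz_def power2_eq_square)
  have "(1 + fst x \<bullet> fst y)\<^sup>2 \<le> (1 + fst x \<bullet> fst x) * (1 + fst y \<bullet> fst y)"
    using Cauchy_Schwarz_ineq[of "fst x" "fst y"] inner_ge_zero[of "fst x - fst y"]
    by (simp add: inner_diff inner_commute algebra_simps power2_eq_square)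
  also have "\<dots> = (snd x * snd y)\<^sup>2" by (simp add: power_mult_distrib x y)
  finally have sq: "(1 + fst x \<bullet> fst y)\<^sup>2 \<le> (snd x * snd y)\<^sup>2" .
  have "1 + fst x \<bullet> fst y \<le> snd x * snd y"
    by (rule power2_le_imp_le[OF sq]) (simp add: pos less_imp_le)
  then show ?thesis by (simp add: lorentz_def)
qed

definition exp_curve :: "minkowski \<Rightarrow> minkowski \<Rightarrow> real \<Rightarrow> minkowski" where
  "exp_curve x v t = (let n = sqrt (lorentz v v) in cosh (n * t) *\<^sub>R x + (sinh (n * t) / n) *\<^sub>R v)"

lemma geodesic_eq_exp_curve:
  assumes "geodesic c c'" and t: "t \<in> {0..1}"
  shows "c' 0 \<in> tangent_space (c 0)" and "c t = exp_curve (c 0) (c' 0) t"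
proof -
  let ?D = "\<lambda>f d t. (f has_vector_derivative d) (at t within {0..1::real})"
  have c: "c t \<in> hyp_plane" "?D c (c' t) t" if "t \<in> {0..1}" for t
    using assms that by (auto simp: geodesic_def)
  obtain a where a: "?D c' (a t) t" "tangent_proj (c t) (a t) = 0" if "t \<in> {0..1}" for t
    using assms unfolding geodesic_def by metis
  have tan: "lorentz (c t) (c' t) = 0" if t: "t \<in> {0..1}" for t
  proof -
    have "((\<lambda>t. -1) has_vector_derivative lorentz (c t) (c' t) + lorentz (c' t) (c t)) (at t within {0..1})"
      by (rule has_vector_derivative_transform[OF t _ lorentz_has_derivative[OF c(2)[OF t] c(2)[OF t]]])
        (use c(1) in \<open>auto simp: hyp_plane_def\<close>)
    from has_vector_derivative_unique_01[OF this has_vector_derivative_const t] show ?thesis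
      by (simp add: lorentz_commute)
  qed
  have acc: "a t = lorentz (c' t) (c' t) *\<^sub>R c t" if t: "t \<in> {0..1}" for t
  proof -
    have "((\<lambda>t. 0) has_vector_derivative lorentz (c t) (a t) + lorentz (c' t) (c' t)) (at t within {0..1})"
      by (rule has_vector_derivative_transform[OF t _ lorentz_has_derivative[OF c(2)[OF t] a(1)[OF t]]])
        (use tan in auto)
    from has_vector_derivative_unique_01[OF this has_vector_derivative_const t]
    have "lorentz (c t) (a t) = - lorentz (c' t) (c' t)" by simp
    then show ?thesis using a(2)[OF t] by (simp add: tangent_proj_def)
  qed
  define k where "k = lorentz (c' 0) (c' 0)"
  have k: "lorentz (c' t) (c' t) = k" if t: "t \<in> {0..1}" for t
    unfolding k_def
  proof (rule constant_01[OF _ t])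
    fix s :: real assume s: "s \<in> {0..1}"
    show "?D (\<lambda>t. lorentz (c' t) (c' t)) 0 s"
      using lorentz_has_derivative[OF a(1)[OF s] a(1)[OF s]] tan[OF s] acc[OF s]
      by (simp add: lorentz_simps lorentz_commute)
  qed
  have d: "?D c' (k *\<^sub>R c t) t" if "t \<in> {0..1}" for t
    using a(1)[OF that] acc[OF that] k[OF that] by simp
  show tan0: "c' 0 \<in> tangent_space (c 0)" using tan[of 0] by (simp add: tangent_space_def)
  have k0: "k \<ge> 0" unfolding k_def
    by (rule lorentz_tangent_nonneg[OF c(1)[of 0] tan0]) simp
  define n where "n = sqrt k"
  have kn: "k = n * n" using k0 by (simp add: n_def)
  show "c t = exp_curve (c 0) (c' 0) t"
  proof (cases "k = 0")
    case True
    have z: "c' s = 0" if "s \<in> {0..1}" for s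
      using lorentz_tangent_zero[OF c(1)[OF that]] tan[OF that] k[OF that] True
      by (simp add: tangent_space_def)
    have "c t = c 0"
      by (rule constant_01[OF _ t]) (use c(2) z in metis)
    then show ?thesis using z[of 0] by (simp add: exp_curve_def Let_def lorentz_simps)
  next
    case False
    then have n: "n \<noteq> 0" by (simp add: n_def)
    have 1: "cosh (n*t) *\<^sub>R c t - (sinh (n*t) / n) *\<^sub>R c' t = c 0"
    proof -
      have "cosh (n*t) *\<^sub>R c t - (sinh (n*t) / n) *\<^sub>R c' t = cosh (n*0) *\<^sub>R c 0 - (sinh (n*0) / n) *\<^sub>R c' 0"
        by (rule constant_01[OF _ t])
          (auto intro!: derivative_eq_intros c(2) d simp: n kn algebra_simps
             simp flip: has_real_derivative_iff_has_vector_derivative)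
      then show ?thesis by simp
    qed
    have 2: "cosh (n*t) *\<^sub>R c' t - (n * sinh (n*t)) *\<^sub>R c t = c' 0"
    proof -
      have "cosh (n*t) *\<^sub>R c' t - (n * sinh (n*t)) *\<^sub>R c t = cosh (n*0) *\<^sub>R c' 0 - (n * sinh (n*0)) *\<^sub>R c 0"
        by (rule constant_01[OF _ t])
          (auto intro!: derivative_eq_intros c(2) d simp: n kn algebra_simps
             simp flip: has_real_derivative_iff_has_vector_derivative)
      then show ?thesis by simp
    qed
    have "cosh (n*t) *\<^sub>R c 0 + (sinh (n*t) / n) *\<^sub>R c' 0 = ((cosh (n*t))\<^sup>2 - (sinh (n*t))\<^sup>2) *\<^sub>R c t"
      unfolding 1[symmetric] 2[symmetric] using n
      by (simp add: algebra_simps power2_eq_square)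
    then show ?thesis
      by (simp add: exp_curve_def Let_def cosh_square_eq flip: k_def n_def)
  qed
qed

lemma exp_curve_geodesic:
  assumes x: "x \<in> hyp_plane" and v: "v \<in> tangent_space x"
  shows "\<exists>c'. geodesic (exp_curve x v) c' \<and> c' 0 = v"
    and "exp_curve x v 0 = x" and "exp_curve x v t \<in> hyp_plane"
proof -
  define n where "n = sqrt (lorentz v v)"
  have nn: "lorentz v v = n\<^sup>2" using lorentz_tangent_nonneg[OF x v] by (simp add: n_def)
  have n0: "v = 0" if "n = 0" using lorentz_tangent_zero[OF x v] nn that by simp
  have e: "exp_curve x v t = cosh (n*t) *\<^sub>R x + (sinh (n*t) / n) *\<^sub>R v" for t
    by (simp add: exp_curve_def n_def Let_def)
  have xx: "lorentz x x = -1" "snd x > 0" "lorentz x v = 0" "lorentz v x = 0"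
    using x v by (auto simp: hyp_plane_def tangent_space_def lorentz_commute)
  have l: "lorentz (exp_curve x v t) (exp_curve x v t) = -1" for t
  proof (cases "n = 0")
    case False
    then show ?thesis
      using cosh_square_eq[of "n*t"]
      by (simp add: e lorentz_simps xx nn power2_eq_square field_simps)
  qed (simp add: e lorentz_simps xx)
  have p: "snd (exp_curve x v t) > 0" for t
  proof -
    have ne: "snd (exp_curve x v s) \<noteq> 0" for s
    proof
      assume "snd (exp_curve x v s) = 0"
      then have "lorentz (exp_curve x v s) (exp_curve x v s) \<ge> 0" by (simp add: lorentz_def)
      then show False using l[of s] by simp
    qed
    have cont: "continuous_on UNIV (\<lambda>s. snd (exp_curve x v s))"
      unfolding e by (cases "n = 0") (auto intro!: continuous_intros)
    have "connected ((\<lambda>s. snd (exp_curve x v s)) ` UNIV)"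
      by (rule connected_continuous_image[OF cont connected_UNIV])
    moreover have "snd (exp_curve x v 0) > 0" by (simp add: e xx)
    ultimately show ?thesis
      using ne connectedD_interval[of "range (\<lambda>s. snd (exp_curve x v s))" "snd (exp_curve x v t)" "snd (exp_curve x v 0)" 0]
      by (metis (no_types, lifting) imageE less_eq_real_def linorder_not_less rangeI)
  qed
  have H: "exp_curve x v t \<in> hyp_plane" for t
    using l p by (simp add: hyp_plane_def)
  then show "exp_curve x v t \<in> hyp_plane" .
  show "exp_curve x v 0 = x" by (simp add: e)
  define d where "d t = (n * sinh (n*t)) *\<^sub>R x + cosh (n*t) *\<^sub>R v" for t
  have 1: "(exp_curve x v has_vector_derivative d t) (at t within {0..1})" for t
  proof (cases "n = 0")
    case True
    have "exp_curve x v = (\<lambda>t. x)" using True by (intro ext) (simp add: e)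
    then show ?thesis using n0[OF True] True by (simp add: d_def)
  next
    case False
    then show ?thesis unfolding e[abs_def] d_def
      by (auto intro!: derivative_eq_intros simp: algebra_simps
            simp flip: has_real_derivative_iff_has_vector_derivative)
  qed
  have 2: "(d has_vector_derivative n\<^sup>2 *\<^sub>R exp_curve x v t) (at t within {0..1})" for t
    unfolding e[abs_def] d_def[abs_def]
    by (auto intro!: derivative_eq_intros simp: algebra_simps power2_eq_square
          simp flip: has_real_derivative_iff_has_vector_derivative)
  have 3: "tangent_proj (exp_curve x v t) (n\<^sup>2 *\<^sub>R exp_curve x v t) = 0" for t
    by (simp add: tangent_proj_def lorentz_simps l)
  have "geodesic (exp_curve x v) d" unfolding geodesic_def using H 1 2 3 by blast
  moreover have "d 0 = v" by (simp add: d_def)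
  ultimately show "\<exists>c'. geodesic (exp_curve x v) c' \<and> c' 0 = v" by blast
qed

lemma hyp_exp_eq:
  assumes "x \<in> hyp_plane" "v \<in> tangent_space x"
  shows "hyp_exp x v =
    cosh (sqrt (lorentz v v)) *\<^sub>R x + (sinh (sqrt (lorentz v v)) / sqrt (lorentz v v)) *\<^sub>R v"
proof -
  have "hyp_exp x v = exp_curve x v 1"
    unfolding hyp_exp_def
  proof (rule the_equality)
    show "\<exists>c c'. geodesic c c' \<and> c 0 = x \<and> c' 0 = v \<and> c 1 = exp_curve x v 1"
      using exp_curve_geodesic(1,2)[OF assms] by blast
  next
    fix y assume "\<exists>c c'. geodesic c c' \<and> c 0 = x \<and> c' 0 = v \<and> c 1 = y"
    then obtain c c' where c: "geodesic c c'" "c 0 = x" "c' 0 = v" "c 1 = y" by blast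
    then show "y = exp_curve x v 1" using geodesic_eq_exp_curve(2)[OF c(1), of 1] by simp
  qed
  then show ?thesis by (simp add: exp_curve_def Let_def)
qed

lemma bij_betw_hyp_exp:
  assumes x: "x \<in> hyp_plane"
  shows "bij_betw (hyp_exp x) (tangent_space x) hyp_plane"
proof (rule bij_betw_imageI)
  let ?n = "\<lambda>v. sqrt (lorentz v v)"
  have xx: "lorentz x x = -1" using x by (simp add: hyp_plane_def)
  have lx: "lorentz x (hyp_exp x v) = - cosh (?n v)" if "v \<in> tangent_space x" for v
    using that by (simp add: hyp_exp_eq[OF x that] lorentz_simps xx tangent_space_def)
  show "inj_on (hyp_exp x) (tangent_space x)"
  proof (rule inj_onI)
    fix v w assume vw: "v \<in> tangent_space x" "w \<in> tangent_space x" and eq: "hyp_exp x v = hyp_exp x w"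
    have nonneg: "?n v \<ge> 0" "?n w \<ge> 0" using vw lorentz_tangent_nonneg[OF x] by auto
    have n: "?n v = ?n w"
      using lx[OF vw(1)] lx[OF vw(2)] eq nonneg by (metis arcosh_cosh_real neg_equal_iff_equal)
    show "v = w"
    proof (cases "?n v = 0")
      case True
      then show ?thesis using n lorentz_tangent_zero[OF x] vw by (metis real_sqrt_eq_zero_cancel_iff)
    next
      case False
      have "(sinh (?n v) / ?n v) *\<^sub>R v = (sinh (?n v) / ?n v) *\<^sub>R w"
        using eq by (simp add: hyp_exp_eq[OF x] vw n)
      moreover have "sinh (?n v) / ?n v \<noteq> 0" using False by simp
      ultimately show ?thesis by (metis scaleR_cancel_left)
    qed
  qed
  show "hyp_exp x ` tangent_space x = hyp_plane"
  proof
    show "hyp_exp x ` tangent_space x \<subseteq> hyp_plane"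
      using exp_curve_geodesic(3)[OF x, of _ 1] by (auto simp: hyp_exp_eq[OF x] exp_curve_def Let_def)
    show "hyp_plane \<subseteq> hyp_exp x ` tangent_space x"
    proof
      fix y assume y: "y \<in> hyp_plane"
      define C where "C = - lorentz x y"
      define w where "w = y - C *\<^sub>R x"
      have C1: "C \<ge> 1" using lorentz_hyp_le[OF x y] by (simp add: C_def)
      have w: "w \<in> tangent_space x"
        by (simp add: w_def tangent_space_def lorentz_simps xx C_def)
      have yy: "lorentz y y = -1" using y by (simp add: hyp_plane_def)
      have lw: "lorentz w w = C\<^sup>2 - 1"
        using xx yy by (simp add: w_def lorentz_simps lorentz_commute[of y x] power2_eq_square algebra_simps C_def)
      show "y \<in> hyp_exp x ` tangent_space x"
      proof (cases "C = 1")
        case True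
        then have "w = 0" using lw lorentz_tangent_zero[OF x w] by simp
        then have "hyp_exp x 0 = y"
          using True by (simp add: hyp_exp_eq[OF x] tangent_space_def lorentz_simps w_def)
        moreover have "0 \<in> tangent_space x" by (simp add: tangent_space_def lorentz_simps)
        ultimately show ?thesis by blast
      next
        case False
        define n where "n = arcosh C"
        have n: "n > 0" "cosh n = C"
          using C1 False by (simp_all add: n_def)
        have s: "sinh n > 0" using n by simp
        have s2: "lorentz w w = sinh n * sinh n"
          using n lw cosh_square_eq[of n] by (simp add: power2_eq_square)
        let ?v = "(n / sinh n) *\<^sub>R w"
        have v: "?v \<in> tangent_space x" using w by (simp add: tangent_space_def lorentz_simps)
        have "lorentz ?v ?v = n\<^sup>2"
          using s by (simp add: lorentz_simps s2 power2_eq_square)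
        then have "?n ?v = n" using n by simp
        then have "hyp_exp x ?v = C *\<^sub>R x + w"
          using n s by (simp add: hyp_exp_eq[OF x v] del: scaleR_scaleR) simp
        then show ?thesis using v by (auto simp: w_def image_iff intro!: bexI[of _ ?v])
      qed
    qed
  qed
qed

end

theory Submission
  imports Defs
begin

text \<open>
  The function \<open>y \<mapsto> \<langle>g, log\<^sub>x y\<rangle>\<close> is not g-convex on the hyperbolic plane, so the lower bound
  imposed at one data point can exceed, at the midpoint of the other two, the upper bound imposed
  by g-convexity there. In an isosceles triangle with apex \<open>x\<^sub>3\<close>, let \<open>z\<close> be the midpoint of the
  base \<open>x\<^sub>1 x\<^sub>2\<close> and let \<open>g\<^sub>3\<close> be the unit vector pointing away from \<open>z\<close>. The bound from \<open>x\<^sub>3\<close>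
  at \<open>z\<close> is minus the height \<open>d\<close>, while at \<open>x\<^sub>1\<close> and \<open>x\<^sub>2\<close> it is \<open>- r cos \<theta>\<close>, with \<open>r\<close> the
  length of the legs and \<open>2 \<theta>\<close> the apex angle. Since \<open>tanh d = tanh r cos \<theta>\<close> and \<open>tanh\<close> is strictly
  concave on the positive half-line, \<open>d < r cos \<theta>\<close>. Taking \<open>F\<^sub>1 = F\<^sub>2 = - r cos \<theta>\<close>, \<open>F\<^sub>3 = 0\<close> and
  \<open>g\<^sub>1 = g\<^sub>2 = 0\<close> gives the data. We use \<open>r = ln 3\<close> and \<open>d = ln 2\<close>, whose hyperbolic
  sines and cosines are rational, so that \<open>d < r cos \<theta>\<close> becomes \<open>ln 2 < 3/4 * ln 3\<close>.
\<close>

lemma hyp_log_hyp_exp: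
  assumes "x \<in> hyp_plane" "v \<in> tangent_space x"
  shows "hyp_log x (hyp_exp x v) = v"
  using the_inv_into_f_f[OF bij_betw_imp_inj_on[OF bij_betw_hyp_exp]] assms
  by (simp add: hyp_log_def)

lemma hyp_log_self:
  assumes "x \<in> hyp_plane"
  shows "hyp_log x x = 0"
proof -
  have 0: "0 \<in> tangent_space x" by (simp add: tangent_space_def lorentz_simps)
  show ?thesis
    using hyp_log_hyp_exp[OF assms 0] by (simp add: hyp_exp_eq[OF assms 0] lorentz_simps)
qed

text \<open>\<open>n\<close> is the distance from \<open>x\<close> to \<open>y\<close>. The
  tangential part of \<open>y\<close> at \<open>x\<close> has length \<open>sinh n\<close>; rescaled
  to length \<open>n\<close>, it is sent to \<open>y\<close> by \<open>hyp_exp x\<close>.\<close>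

lemma hyp_log_eq:
  assumes x: "x \<in> hyp_plane" and y: "y \<in> hyp_plane"
    and n: "n > 0" "lorentz x y = - cosh n"
  shows "hyp_log x y = (n / sinh n) *\<^sub>R (y - cosh n *\<^sub>R x)"
proof -
  let ?w = "y - cosh n *\<^sub>R x"
  let ?v = "(n / sinh n) *\<^sub>R ?w"
  have xx: "lorentz x x = -1" and yy: "lorentz y y = -1"
    using x y by (auto simp: hyp_plane_def)
  have v: "?v \<in> tangent_space x"
    by (simp add: tangent_space_def lorentz_simps xx n)
  have s: "sinh n > 0" using n by simp
  have "lorentz ?w ?w = (sinh n)\<^sup>2"
    using cosh_square_eq[of n]
    by (simp add: lorentz_simps xx yy n lorentz_commute[of y x] power2_eq_square algebra_simps)
  moreover have "lorentz ?v ?v = (n / sinh n) * ((n / sinh n) * lorentz ?w ?w)"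
    by (simp only: lorentz_simps(5,6))
  ultimately have "lorentz ?v ?v = n\<^sup>2"
    using s by (simp add: power2_eq_square)
  then have "sqrt (lorentz ?v ?v) = n" using n by simp
  then have "hyp_exp x ?v = y"
    using n s by (simp add: hyp_exp_eq[OF x v] del: scaleR_scaleR) simp
  then show ?thesis using hyp_log_hyp_exp[OF x v] by simp
qed

lemma g_convex_hyperbolic_midpoint:
  assumes f: "g_convex f" and z: "z \<in> hyp_plane" and e: "e \<in> tangent_space z" "lorentz e e = 1"
  shows "f z \<le> (f (cosh s *\<^sub>R z + sinh s *\<^sub>R e) + f (cosh s *\<^sub>R z - sinh s *\<^sub>R e)) / 2"
proof -
  define p where "p u = cosh u *\<^sub>R z + sinh u *\<^sub>R e" for u
  define q where "q u = sinh u *\<^sub>R z + cosh u *\<^sub>R e" for u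
  have ll: "lorentz z z = -1" "lorentz z e = 0" "lorentz e z = 0" "lorentz e e = 1"
    using z e by (auto simp: hyp_plane_def tangent_space_def lorentz_commute)
  have pp: "lorentz (p u) (p u) = -1" for u
    using cosh_square_eq[of u] by (simp add: p_def lorentz_simps ll power2_eq_square)
  have H: "p u \<in> hyp_plane" for u
  proof -
    have "p u = exp_curve z e u" by (simp add: exp_curve_def Let_def p_def e)
    then show ?thesis using exp_curve_geodesic(3)[OF z e(1)] by simp
  qed
  \<comment> \<open>The parameter runs from \<open>s\<close> to \<open>- s\<close>, so
    \<open>c\<close> is at \<open>z\<close> when \<open>t = 1/2\<close>.\<close>
  define c where "c t = p (s * (1 - 2 * t))" for t
  define c' where "c' t = (- 2 * s) *\<^sub>R q (s * (1 - 2 * t))" for t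
  have 1: "(c has_vector_derivative c' t) (at t within {0..1})" for t
    unfolding c_def[abs_def] c'_def p_def q_def
    by (auto intro!: derivative_eq_intros simp: algebra_simps
          simp flip: has_real_derivative_iff_has_vector_derivative)
  have 2: "(c' has_vector_derivative (4 * s\<^sup>2) *\<^sub>R c t) (at t within {0..1})" for t
    unfolding c_def c'_def[abs_def] p_def q_def
    by (auto intro!: derivative_eq_intros simp: algebra_simps power2_eq_square
          simp flip: has_real_derivative_iff_has_vector_derivative)
  have 3: "tangent_proj (c t) ((4 * s\<^sup>2) *\<^sub>R c t) = 0" for t
    by (simp add: tangent_proj_def lorentz_simps c_def pp)
  have "geodesic c c'" unfolding geodesic_def using H 1 2 3 c_def by metis
  moreover have "c 0 \<in> hyp_plane" "c 1 \<in> hyp_plane" using H by (auto simp: c_def)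
  moreover have "1/2 \<in> {0..1::real}" by simp
  ultimately have "f (c (1/2)) \<le> (1 - 1/2) * f (c 0) + 1/2 * f (c 1)"
    using f unfolding g_convex_def by blast
  then show ?thesis by (simp add: c_def p_def)
qed

theorem proposition16:
  "\<exists>(F :: nat \<Rightarrow> real) (x :: nat \<Rightarrow> minkowski) (g :: nat \<Rightarrow> minkowski).
     (\<forall>i\<in>{1..3}. x i \<in> hyp_plane \<and> g i \<in> tangent_space (x i)) \<and>
     (\<forall>i\<in>{1..3}. \<forall>j\<in>{1..3}. F j \<ge> F i + lorentz (g i) (hyp_log (x i) (x j))) \<and>
     \<not> (\<exists>f. g_convex f \<and> interpolates 3 F x g f)"
proof -
  define z :: minkowski where "z = (0, 1)"
  define e1 :: minkowski where "e1 = (axis 1 1, 0)"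
  define e2 :: minkowski where "e2 = (axis 2 1, 0)"
  have ll: "lorentz z z = -1" "lorentz z e1 = 0" "lorentz e1 z = 0" "lorentz z e2 = 0"
    "lorentz e2 z = 0" "lorentz e1 e1 = 1" "lorentz e2 e2 = 1" "lorentz e1 e2 = 0" "lorentz e2 e1 = 0"
    by (simp_all add: lorentz_def z_def e1_def e2_def inner_axis_axis)
  have snds: "snd z = 1" "snd e1 = 0" "snd e2 = 0" by (simp_all add: z_def e1_def e2_def)
  have z: "z \<in> hyp_plane" by (simp add: hyp_plane_def ll snds)
  have e2: "e2 \<in> tangent_space z" by (simp add: tangent_space_def ll)
  define s :: real where "s = arcosh (4/3)"
  \<comment> \<open>Pythagoras: \<open>cosh r = cosh d cosh s\<close> is \<open>5/3 = 5/4 * 4/3\<close>.\<close>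
  have s: "cosh s = 4/3" by (simp add: s_def)
  have ss: "sinh s * sinh s = 7/9"
    using cosh_square_eq[of s] by (simp add: s power2_eq_square)
  have d: "cosh (ln 2 :: real) = 5/4" "sinh (ln 2 :: real) = 3/4"
    and r: "cosh (ln 3 :: real) = 5/3" "sinh (ln 3 :: real) = 4/3"
    by (simp_all add: cosh_ln_real sinh_ln_real)
  define a where "a = cosh s *\<^sub>R z + sinh s *\<^sub>R e2"
  define b where "b = cosh s *\<^sub>R z - sinh s *\<^sub>R e2"
  \<comment> \<open>\<open>p\<close> is at distance \<open>ln 2\<close> from \<open>z\<close> in
    direction \<open>- e1\<close>; \<open>h\<close> is the unit velocity there of the geodesic from
    \<open>z\<close>.\<close>
  define p where "p = (5/4) *\<^sub>R z - (3/4) *\<^sub>R e1"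
  define h where "h = (3/4) *\<^sub>R z - (5/4) *\<^sub>R e1"
  have a: "a \<in> hyp_plane" and b: "b \<in> hyp_plane" and p: "p \<in> hyp_plane"
    by (simp_all add: hyp_plane_def a_def b_def p_def lorentz_simps ll snds s ss)
  have h: "h \<in> tangent_space p" by (simp add: tangent_space_def h_def p_def lorentz_simps ll)
  have ha: "lorentz h (hyp_log p a) = - (3/4) * ln 3"
    by (subst hyp_log_eq[OF p a, of "ln 3"])
      (simp_all add: a_def p_def h_def lorentz_simps ll s r)
  have hb: "lorentz h (hyp_log p b) = - (3/4) * ln 3"
    by (subst hyp_log_eq[OF p b, of "ln 3"])
      (simp_all add: b_def p_def h_def lorentz_simps ll s r)
  have hz: "lorentz h (hyp_log p z) = - ln 2"
    by (subst hyp_log_eq[OF p z, of "ln 2"])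
      (simp_all add: p_def h_def lorentz_simps ll d)
  \<comment> \<open>This is 16 < 27.\<close>
  have "ln (2 ^ 4 :: real) < ln (3 ^ 3)" by (subst ln_less_cancel_iff) simp_all
  then have gap: "ln 2 < (3/4) * ln (3::real)" by (simp only: ln_realpow zero_less_numeral)
  define F :: "nat \<Rightarrow> real" where "F i = (if i = 3 then 0 else - (3/4) * ln 3)" for i
  define x where "x i = (if i = 1 then a else if i = 2 then b else p)" for i :: nat
  define g where "g i = (if i = 3 then h else 0)" for i :: nat
  have I: "{1..3} = {1, 2, 3::nat}" by auto
  have "\<forall>i\<in>{1..3}. x i \<in> hyp_plane \<and> g i \<in> tangent_space (x i)"
    using a b p h by (simp add: I x_def g_def tangent_space_def lorentz_simps)
  moreover have "\<forall>i\<in>{1..3}. \<forall>j\<in>{1..3}. F j \<ge> F i + lorentz (g i) (hyp_log (x i) (x j))"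
    by (simp add: I F_def x_def g_def lorentz_simps ha hb hyp_log_self[OF p])
  moreover have False if f: "g_convex f" and int: "interpolates 3 F x g f" for f
  proof -
    have vals: "f a = - (3/4) * ln 3" "f b = - (3/4) * ln 3" "f p = 0"
      and "h \<in> subdifferential f p"
      using int unfolding interpolates_def I by (simp_all add: F_def x_def g_def)
    then have "f z \<ge> - ln 2"
      using z hz by (auto simp: subdifferential_def)
    moreover have "f z \<le> - (3/4) * ln 3"
      using g_convex_hyperbolic_midpoint[OF f z e2, of s] vals by (simp add: ll a_def b_def)
    ultimately show False using gap by simp
  qed
  ultimately show ?thesis by blast
qed

end
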